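(* Let $\mathcal{X}$ be a Polish space and let $H_0$ versus $H_1$ be a hypothesis testing problem over $\mathcal{X}$ such that each hypothesis $H_i$ ($i\in\{0,1\}$) is dense in the union $H_0\cup H_1$ (with respect to the weak topology). Then no finite-precision test $\varphi$ for $H_0$ versus $H_1$ achieves the following two standards simultaneously: (1) $\varphi$ is densely consistent in each hypothesis; (2) $\varphi$ is nonmeagerly consistent.
   Context: $\mathcal{X}$ is a Polish space with Borel $\sigma$-algebra $\mathscr{B}(\mathcal{X})$. The set of all probability measures on $\mathscr{B}(\mathcal{X})$ carries the weak topology (the topology of weak convergence of measures), and every subset of it carries the subspace topology. A hypothesis is a set of probability measures on $\mathscr{B}(\mathcal{X})$; a hypothesis testing problem consists of two disjoint hypotheses $H_0$ and $H_1$. The ambient topological space is $H_0\cup H_1$ with the subspace topology. A test $\varphi$ is a sequence of measurable functions $\varphi_n:\mathcal{X}^n\to\{0,1,\texttt{?}\}$, $n=1,2,\ldots$; write $\{\varphi_n=i\}=\{x\in\mathcal{X}^n:\varphi_n(x)=i\}$. The test $\varphi$ is finite-precision iff for every $n$ and every $i\in\{0,1\}$ the set $\{\varphi_n=i\}$ is open in $\mathcal{X}^n$ (product topology). For $\mathbb{P}\in H_i$, $\varphi$ is consistent at $\mathbb{P}$ iff $\mathbb{P}^n\{\varphi_n=i\}\to 1$ as $n\to\infty$, where $\mathbb{P}^n$ is the $n$-fold product measure of $\mathbb{P}$; $\varphi$ is consistent on a set $S$ iff it is consistent at every element of $S$. Meager, nonmeager (= not meager) and comeager (= complement meager) have their standard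 Baire-category meanings. $\varphi$ is densely consistent in each hypothesis iff, for each $i\in\{0,1\}$, $\varphi$ is consistent on some dense subset of $H_i$ (with its own subspace topology). $\varphi$ is nonmeagerly consistent iff it is consistent on some subset of $H_0\cup H_1$ that is nonmeager in the space $H_0\cup H_1$. *)

theory Defs
  imports "HOL-Probability.Probability"
begin

definition borel_probs :: "'a::polish_space measure set" where
  "borel_probs = {P. prob_space P \<and> sets P = sets borel}"

text \<open>
  The library defines weak convergence for measures on the real line only.  The weak topology
  on all Borel probability measures is the coarsest one that makes \<open>P \<mapsto> \<integral>x. f x \<partial>P\<close> continuous
  for every bounded continuous real function \<open>f\<close>.
\<close>
definition weak_topology :: "'a::polish_space measure topology" where
  "weak_topology = topology_generated_by
     {{P \<in> borel_probs. (\<integral>x. f x \<partial>P) \<in> U} | (f :: 'a \<Rightarrow> real) U.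
        continuous_on UNIV f \<and> bounded (range f) \<and> open U}"

definition dense_in :: "'b topology \<Rightarrow> 'b set \<Rightarrow> bool" where
  "dense_in T S \<longleftrightarrow> S \<subseteq> topspace T \<and> T closure_of S = topspace T"

definition nowhere_dense_in :: "'b topology \<Rightarrow> 'b set \<Rightarrow> bool" where
  "nowhere_dense_in T S \<longleftrightarrow> S \<subseteq> topspace T \<and> T interior_of (T closure_of S) = {}"

definition meager_in :: "'b topology \<Rightarrow> 'b set \<Rightarrow> bool" where
  "meager_in T S \<longleftrightarrow>
     (\<exists>\<F>. countable \<F> \<and> (\<forall>A\<in>\<F>. nowhere_dense_in T A) \<and> S = \<Union>\<F>)"

definition nonmeager_in :: "'b topology \<Rightarrow> 'b set \<Rightarrow> bool" where
  "nonmeager_in T S \<longleftrightarrow> S \<subseteq> topspace T \<and> \<not> meager_in T S"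

definition testing_problem ::
  "'a::polish_space measure set \<Rightarrow> 'a measure set \<Rightarrow> bool" where
  "testing_problem H0 H1 \<longleftrightarrow> H0 \<subseteq> borel_probs \<and> H1 \<subseteq> borel_probs \<and> H0 \<inter> H1 = {}"

text \<open>The three values stand for 0, 1 and ?, respectively.\<close>
datatype verdict = Verdict0 | Verdict1 | Undecided

text \<open>
  A sample of size \<open>n\<close> is an element of \<open>{..<n} \<rightarrow>\<^sub>E UNIV\<close>, the carrier of both the product
  measurable space and the product topology on index set \<open>{..<n}\<close>.  Only sizes \<open>n \<ge> 1\<close>, and
  only the values on such samples, are constrained.
\<close>
definition event :: "(nat \<Rightarrow> (nat \<Rightarrow> 'a) \<Rightarrow> verdict) \<Rightarrow> nat \<Rightarrow> verdict \<Rightarrow> (nat \<Rightarrow> 'a) set" where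
  "event \<phi> n v = {x \<in> {..<n} \<rightarrow>\<^sub>E UNIV. \<phi> n x = v}"

definition is_test :: "(nat \<Rightarrow> (nat \<Rightarrow> 'a::polish_space) \<Rightarrow> verdict) \<Rightarrow> bool" where
  "is_test \<phi> \<longleftrightarrow>
     (\<forall>n\<ge>1. \<phi> n \<in> measurable (\<Pi>\<^sub>M i\<in>{..<n}. borel) (count_space UNIV))"

definition finite_precision :: "(nat \<Rightarrow> (nat \<Rightarrow> 'a::polish_space) \<Rightarrow> verdict) \<Rightarrow> bool" where
  "finite_precision \<phi> \<longleftrightarrow>
     (\<forall>n\<ge>1. \<forall>v\<in>{Verdict0, Verdict1}.
        openin (product_topology (\<lambda>_. euclidean) {..<n}) (event \<phi> n v))"

definition consistent_at ::
  "(nat \<Rightarrow> (nat \<Rightarrow> 'a::polish_space) \<Rightarrow> verdict) \<Rightarrow> verdict \<Rightarrow> 'a measure \<Rightarrow> bool" where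
  "consistent_at \<phi> v P \<longleftrightarrow>
     (\<lambda>n. measure (\<Pi>\<^sub>M i\<in>{..<n}. P) (event \<phi> n v)) \<longlonglongrightarrow> 1"

definition consistent_on ::
  "(nat \<Rightarrow> (nat \<Rightarrow> 'a::polish_space) \<Rightarrow> verdict) \<Rightarrow>
     'a measure set \<Rightarrow> 'a measure set \<Rightarrow> 'a measure set \<Rightarrow> bool" where
  "consistent_on \<phi> H0 H1 S \<longleftrightarrow> S \<subseteq> H0 \<union> H1 \<and>
     (\<forall>P\<in>S \<inter> H0. consistent_at \<phi> Verdict0 P) \<and>
     (\<forall>P\<in>S \<inter> H1. consistent_at \<phi> Verdict1 P)"

definition densely_consistent_in_each ::
  "(nat \<Rightarrow> (nat \<Rightarrow> 'a::polish_space) \<Rightarrow> verdict) \<Rightarrow>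
     'a measure set \<Rightarrow> 'a measure set \<Rightarrow> bool" where
  "densely_consistent_in_each \<phi> H0 H1 \<longleftrightarrow>
     (\<forall>H\<in>{H0, H1}.
        \<exists>S. dense_in (subtopology weak_topology H) S \<and> consistent_on \<phi> H0 H1 S)"

definition nonmeagerly_consistent ::
  "(nat \<Rightarrow> (nat \<Rightarrow> 'a::polish_space) \<Rightarrow> verdict) \<Rightarrow>
     'a measure set \<Rightarrow> 'a measure set \<Rightarrow> bool" where
  "nonmeagerly_consistent \<phi> H0 H1 \<longleftrightarrow>
     (\<exists>S. nonmeager_in (subtopology weak_topology (H0 \<union> H1)) S \<and> consistent_on \<phi> H0 H1 S)"

end

theory Submission
  imports Defs
begin

text \<open>
  For an open event \<open>U\<close> in the \<open>n\<close>-fold sample space, the probability of \<open>U\<close> under the \<open>n\<close>-fold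
  power of \<open>P\<close> is a lower semicontinuous function of \<open>P\<close> in the weak topology
  (\<open>open_event_lower_semicontinuous\<close>).  For a finite-precision test it follows that the set of
  those \<open>P\<close> that give a fixed verdict probability above \<open>1/2\<close> at some sample size beyond \<open>m\<close>
  is open.  This set contains every \<open>P\<close> at which that verdict is the consistent one.

  If the test is consistent on a dense subset of each hypothesis, and each hypothesis is dense in
  the union, then for either verdict and every \<open>m\<close> this open set is dense in the union, so its
  complement there is nowhere dense (\<open>nowhere_dense_not_likely_later\<close>).  Hence, on a comeager set,
  both verdicts have probability above \<open>1/2\<close> at infinitely many sample sizes.  Since the two
  verdicts exclude each other, neither can have probability tending to 1 there: by
  \<open>consistent_at_other_unlikely\<close> the test is consistent at no point of this comeager set, and any
  set on which it is consistent is meager.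

  The lower semicontinuity is the analytic part.  An open set is a countable union of open boxes,
  and the indicator of a box is the limit of products \<open>f\<^sub>1(x\<^sub>1) \<dots> f\<^sub>n(x\<^sub>n)\<close> of bounded continuous
  functions of the single observations.  The integral of such a product is a product of
  integrals against \<open>P\<close>, hence weakly continuous in \<open>P\<close>.  Combining finitely many boxes by
  inclusion and exclusion stays within the algebra generated by these products, and gives functions
  below the indicator of \<open>U\<close> that converge to it.
\<close>

section \<open>Baire category in abstract topological spaces\<close>

lemma dense_in_trans:
  assumes "dense_in (subtopology T H) S" and "dense_in T H"
  shows "dense_in T S"
proof -
  have H: "H \<subseteq> topspace T" "T closure_of H = topspace T"
    using assms(2) by (auto simp: dense_in_def)
  have S: "S \<subseteq> H" "subtopology T H closure_of S = H"
    using assms(1) H(1) by (auto simp: dense_in_def)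
  have "H \<subseteq> T closure_of S"
    using S by (metis closure_of_subtopology_subset)
  then have "T closure_of H \<subseteq> T closure_of S"
    by (simp add: closure_of_minimal)
  then show ?thesis
    using H S(1) closure_of_subset_topspace[of T S] by (auto simp: dense_in_def)
qed

lemma nowhere_dense_in_complement_of_open_dense:
  assumes "openin T G" and "D \<subseteq> G" and "dense_in T D"
  shows "nowhere_dense_in T (topspace T - G)"
proof -
  have cl: "closedin T (topspace T - G)"
    using assms(1) by blast
  have "T closure_of G = topspace T"
    using assms closure_of_mono[of D G T] closure_of_subset_topspace[of T G]
    by (auto simp: dense_in_def)
  then have "T interior_of (topspace T - G) = {}"
    by (simp add: interior_of_complement)
  then show ?thesis
    using cl by (simp add: nowhere_dense_in_def closure_of_closedin)
qed

lemma nowhere_dense_in_subset: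
  assumes "nowhere_dense_in T B" and "A \<subseteq> B"
  shows "nowhere_dense_in T A"
  using assms interior_of_mono[OF closure_of_mono[OF assms(2)], of T T]
  by (auto simp: nowhere_dense_in_def)

text \<open>
  A meager set is by definition equal to a countable union of nowhere dense sets; intersecting each
  of them with \<open>S\<close> shows that a cover is enough.
\<close>
lemma meager_in_if_covered:
  assumes "countable \<F>" and "\<And>A. A \<in> \<F> \<Longrightarrow> nowhere_dense_in T A" and "S \<subseteq> \<Union>\<F>"
  shows "meager_in T S"
  unfolding meager_in_def
proof (intro exI conjI ballI)
  show "countable ((\<lambda>A. S \<inter> A) ` \<F>)"
    using assms(1) by simp
  show "nowhere_dense_in T A" if "A \<in> (\<lambda>A. S \<inter> A) ` \<F>" for A
    using that assms(2) nowhere_dense_in_subset by blast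
  show "S = \<Union>((\<lambda>A. S \<inter> A) ` \<F>)"
    using assms(3) by auto
qed

section \<open>Integrals of functions of a sample depend continuously on the distribution\<close>

text \<open>
  The integral of a constant function lies in \<open>UNIV\<close>, so the set of all Borel probability measures
  is itself one of the generating sets.
\<close>
lemma topspace_weak_topology: "topspace weak_topology = borel_probs"
proof -
  have "borel_probs = {P \<in> borel_probs. (\<integral>x. (\<lambda>_::'a. 0::real) x \<partial>P) \<in> UNIV}"
    by simp
  then have "borel_probs \<in> {{P \<in> borel_probs. (\<integral>x. f x \<partial>P) \<in> U} | (f :: 'a \<Rightarrow> real) U.
        continuous_on UNIV f \<and> bounded (range f) \<and> open U}"
    by (intro CollectI exI[of _ "\<lambda>_. 0"] exI[of _ UNIV]) auto
  then show ?thesis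
    unfolding weak_topology_def topology_generated_by_topspace by blast
qed

lemma continuous_map_integral:
  fixes f :: "'a::polish_space \<Rightarrow> real"
  assumes "continuous_on UNIV f" and "bounded (range f)"
  shows "continuous_map weak_topology euclideanreal (\<lambda>P. \<integral>x. f x \<partial>P)"
  unfolding continuous_map_def topspace_weak_topology
proof (intro conjI allI impI)
  fix U :: "real set"
  assume "openin euclideanreal U"
  then show "openin weak_topology {P \<in> borel_probs. (\<integral>x. f x \<partial>P) \<in> U}"
    unfolding weak_topology_def using assms
    by (intro topology_generated_by_Basis CollectI exI[of _ f] exI[of _ U]) auto
qed auto

lemma prob_space_power:
  assumes "P \<in> borel_probs"
  shows "prob_space (\<Pi>\<^sub>M i\<in>I. P)"
  using assms by (intro prob_space_PiM) (auto simp: borel_probs_def)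

lemma sets_power:
  assumes "P \<in> borel_probs"
  shows "sets (\<Pi>\<^sub>M i\<in>I. P) = sets (\<Pi>\<^sub>M i\<in>I. borel)"
  using assms by (intro sets_PiM_cong) (auto simp: borel_probs_def)

lemma borel_measurable_tensor:
  fixes g :: "nat \<Rightarrow> 'a::polish_space \<Rightarrow> real"
  assumes "P \<in> borel_probs" and "\<And>i. continuous_on UNIV (g i)"
  shows "(\<lambda>x. \<Prod>i<n. g i (x i)) \<in> borel_measurable (\<Pi>\<^sub>M i\<in>{..<n}. P)"
proof -
  have [measurable]: "g i \<in> borel_measurable borel" for i
    using assms(2) by (rule borel_measurable_continuous_onI)
  have "(\<lambda>x. \<Prod>i<n. g i (x i)) \<in> borel_measurable (\<Pi>\<^sub>M i\<in>{..<n}. (borel :: 'a measure))"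
    by measurable
  then show ?thesis
    using measurable_cong_sets[OF sets_power[OF assms(1)] refl] by blast
qed

lemma bounded_tensor:
  fixes g :: "nat \<Rightarrow> 'a \<Rightarrow> real"
  assumes "\<And>i. bounded (range (g i))"
  obtains B where "\<And>x. \<bar>\<Prod>i<n. g i (x i)\<bar> \<le> B"
proof -
  have "\<exists>b. \<forall>y. \<bar>g i y\<bar> \<le> b" for i
    using assms[of i] by (auto simp: bounded_iff)
  then obtain b where "\<And>i y. \<bar>g i y\<bar> \<le> b i"
    by metis
  then have "\<bar>\<Prod>i<n. g i (x i)\<bar> \<le> (\<Prod>i<n. b i)" for x
    unfolding abs_prod by (intro prod_mono) auto
  then show ?thesis
    using that by blast
qed

text \<open>By independence, the integral of a product of functions of single observations factorises.\<close>
lemma continuous_map_integral_tensor: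
  fixes g :: "nat \<Rightarrow> 'a::polish_space \<Rightarrow> real"
  assumes "\<And>i. continuous_on UNIV (g i)" and "\<And>i. bounded (range (g i))"
  shows "continuous_map weak_topology euclideanreal
    (\<lambda>P. \<integral>x. (\<Prod>i<n. g i (x i)) \<partial>(\<Pi>\<^sub>M i\<in>{..<n}. P))"
proof -
  have "(\<integral>x. (\<Prod>i<n. g i (x i)) \<partial>(\<Pi>\<^sub>M i\<in>{..<n}. P)) = (\<Prod>i<n. \<integral>y. g i y \<partial>P)"
    if P: "P \<in> borel_probs" for P
  proof -
    interpret prob_space P using P by (simp add: borel_probs_def)
    interpret product_sigma_finite "\<lambda>_::nat. P" by unfold_locales
    have "g i \<in> borel_measurable P" for i
      using P borel_measurable_continuous_onI[OF assms(1)] measurable_cong_sets[of P borel]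
      by (auto simp: borel_probs_def)
    moreover have "\<exists>b. \<forall>y. norm (g i y) \<le> b" for i
      using assms(2)[of i] by (auto simp: bounded_iff)
    ultimately have "integrable P (g i)" for i
      by (metis AE_I2 integrable_const_bound)
    then show ?thesis
      by (intro product_integral_prod) auto
  qed
  moreover have "continuous_map weak_topology euclideanreal (\<lambda>P. \<Prod>i<n. \<integral>y. g i y \<partial>P)"
    using assms by (intro continuous_map_prod continuous_map_integral) auto
  ultimately show ?thesis
    by (rule_tac continuous_map_eq) (auto simp: topspace_weak_topology)
qed

text \<open>
  If \<open>b\<close> approximates indicators of boxes, the second factor approximates the indicator of the
  complement of their union.  Multiplying out this factor one \<open>j\<close> at a time, by
  \<open>g (1 - b\<^sub>j) = g - g b\<^sub>j\<close>, keeps the first factor a product of functions of single observations;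
  the arbitrary \<open>g\<close> is there to make this induction work.
\<close>
lemma continuous_map_integral_tensor_algebra:
  fixes g :: "nat \<Rightarrow> 'a::polish_space \<Rightarrow> real" and b :: "'j \<Rightarrow> nat \<Rightarrow> 'a \<Rightarrow> real"
  assumes "finite J"
    and b: "\<And>j i. continuous_on UNIV (b j i)" "\<And>j i. bounded (range (b j i))"
    and g: "\<And>i. continuous_on UNIV (g i)" "\<And>i. bounded (range (g i))"
  shows "continuous_map weak_topology euclideanreal
      (\<lambda>P. \<integral>x. (\<Prod>i<n. g i (x i)) * (\<Prod>j\<in>J. 1 - (\<Prod>i<n. b j i (x i))) \<partial>(\<Pi>\<^sub>M i\<in>{..<n}. P))"
    and "\<And>P. P \<in> borel_probs \<Longrightarrow> integrable (\<Pi>\<^sub>M i\<in>{..<n}. P)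
      (\<lambda>x. (\<Prod>i<n. g i (x i)) * (\<Prod>j\<in>J. 1 - (\<Prod>i<n. b j i (x i))))"
proof -
  define F where "F J g x = (\<Prod>i<n. g i (x i)) * (\<Prod>j\<in>J. 1 - (\<Prod>i<n. b j i (x i)))"
    for J and g :: "nat \<Rightarrow> 'a \<Rightarrow> real" and x
  have "continuous_map weak_topology euclideanreal (\<lambda>P. \<integral>x. F J g x \<partial>(\<Pi>\<^sub>M i\<in>{..<n}. P)) \<and>
      (\<forall>P\<in>borel_probs. integrable (\<Pi>\<^sub>M i\<in>{..<n}. P) (F J g))"
    using \<open>finite J\<close> g
  proof (induction J arbitrary: g rule: finite_induct)
    case empty
    have "integrable (\<Pi>\<^sub>M i\<in>{..<n}. P) (\<lambda>x. \<Prod>i<n. g i (x i))" if P: "P \<in> borel_probs" for P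
    proof -
      interpret prob_space "\<Pi>\<^sub>M i\<in>{..<n}. P" using P by (rule prob_space_power)
      obtain B where "\<And>x. \<bar>\<Prod>i<n. g i (x i)\<bar> \<le> B"
        using bounded_tensor empty(2) by blast
      then show ?thesis
        by (intro integrable_const_bound[of _ B] borel_measurable_tensor) (use P empty in auto)
    qed
    then show ?case
      using continuous_map_integral_tensor[OF empty] by (simp add: F_def)
  next
    case (insert j J)
    define h where "h i y = g i y * b j i y" for i y
    have h: "continuous_on UNIV (h i)" "bounded (range (h i))" for i
    proof -
      show "continuous_on UNIV (h i)"
        unfolding h_def using insert.prems(1) b(1) by (intro continuous_on_mult)
      show "bounded (range (h i))"
      proof -
        obtain c d where "\<And>y. \<bar>g i y\<bar> \<le> c" "\<And>y. \<bar>b j i y\<bar> \<le> d"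
          using insert.prems(2)[of i] b(2)[of j i] by (auto simp: bounded_iff)
        then have "\<bar>h i y\<bar> \<le> c * d" for y
          unfolding h_def abs_mult by (intro mult_mono') auto
        then show ?thesis
          by (intro boundedI[of _ "c * d"]) auto
      qed
    qed
    have split: "F (insert j J) g = (\<lambda>x. F J g x - F J h x)"
      using insert.hyps by (auto simp: F_def h_def prod.distrib algebra_simps)
    note IHg = insert.IH[of g, OF insert.prems]
    note IHh = insert.IH[of h, OF h]
    have "continuous_map weak_topology euclideanreal
       (\<lambda>P. (\<integral>x. F J g x \<partial>(\<Pi>\<^sub>M i\<in>{..<n}. P)) - (\<integral>x. F J h x \<partial>(\<Pi>\<^sub>M i\<in>{..<n}. P)))"
      using IHg IHh by (intro continuous_map_diff) auto
    then have "continuous_map weak_topology euclideanreal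
       (\<lambda>P. \<integral>x. F (insert j J) g x \<partial>(\<Pi>\<^sub>M i\<in>{..<n}. P))"
      by (rule continuous_map_eq) (use IHg IHh in \<open>auto simp: split topspace_weak_topology\<close>)
    then show ?case
      using IHg IHh by (auto simp: split)
  qed
  then show "continuous_map weak_topology euclideanreal
      (\<lambda>P. \<integral>x. (\<Prod>i<n. g i (x i)) * (\<Prod>j\<in>J. 1 - (\<Prod>i<n. b j i (x i))) \<partial>(\<Pi>\<^sub>M i\<in>{..<n}. P))"
    and "\<And>P. P \<in> borel_probs \<Longrightarrow> integrable (\<Pi>\<^sub>M i\<in>{..<n}. P)
      (\<lambda>x. (\<Prod>i<n. g i (x i)) * (\<Prod>j\<in>J. 1 - (\<Prod>i<n. b j i (x i))))"
    by (auto simp: F_def[abs_def])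
qed

section \<open>Lower semicontinuity of the probability of an open event\<close>

text \<open>
  The approximants are truncated multiples of the distance to the complement.  The whole space is
  a separate case because the distance to the empty set is 0 by convention.
\<close>
lemma open_indicator_approximation:
  fixes W :: "'a::metric_space set"
  assumes "open W"
  obtains f :: "nat \<Rightarrow> 'a \<Rightarrow> real"
  where "\<And>k. continuous_on UNIV (f k)" and "\<And>k y. f k y \<in> {0..1}"
    and "\<And>k y. y \<notin> W \<Longrightarrow> f k y = 0" and "\<And>y. y \<in> W \<Longrightarrow> (\<lambda>k. f k y) \<longlonglongrightarrow> 1"
proof (cases "W = UNIV")
  case True
  then show ?thesis
    by (intro that[of "\<lambda>_ _. 1"]) auto
next
  case False
  show ?thesis
  proof (intro that[of "\<lambda>k y. min 1 (real k * infdist y (- W))"])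
    show "continuous_on UNIV (\<lambda>y. min 1 (real k * infdist y (- W)))" for k
      by (intro continuous_intros)
    fix y assume "y \<in> W"
    then have pos: "infdist y (- W) > 0"
      using False assms infdist_pos_not_in_closed[of "- W" y] by auto
    have "eventually (\<lambda>k. real k \<ge> 1 / infdist y (- W)) sequentially"
      using filterlim_real_sequentially by (simp add: filterlim_at_top)
    then have "eventually (\<lambda>k. min 1 (real k * infdist y (- W)) = 1) sequentially"
      by eventually_elim (use pos in \<open>auto simp: field_simps min_def\<close>)
    then show "(\<lambda>k. min 1 (real k * infdist y (- W))) \<longlonglongrightarrow> 1"
      by (rule tendsto_eventually)
  qed (auto simp: infdist_nonneg)
qed

lemma openin_power_countable_union_boxes:
  fixes U :: "(nat \<Rightarrow> 'a::second_countable_topology) set"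
  assumes "openin (product_topology (\<lambda>_. euclidean) {..<n}) U" and "U \<noteq> {}"
  obtains W :: "nat \<Rightarrow> nat \<Rightarrow> 'a set"
  where "\<And>j i. open (W j i)" and "U = (\<Union>j. Pi\<^sub>E {..<n} (W j))"
proof -
  obtain B :: "'a set set" where B: "countable B" "topological_basis B"
    using ex_countable_basis by blast
  define \<W> where "\<W> = {V \<in> {..<n} \<rightarrow>\<^sub>E B. Pi\<^sub>E {..<n} V \<subseteq> U}"
  have cover: "\<exists>V\<in>\<W>. x \<in> Pi\<^sub>E {..<n} V" if x: "x \<in> U" for x
  proof -
    obtain V where V: "\<And>i. i < n \<Longrightarrow> open (V i)" "x \<in> Pi\<^sub>E {..<n} V" "Pi\<^sub>E {..<n} V \<subseteq> U"
    proof -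
      obtain V where "\<forall>i\<in>{..<n}. openin euclidean (V i)" "x \<in> Pi\<^sub>E {..<n} V" "Pi\<^sub>E {..<n} V \<subseteq> U"
        using assms(1) x unfolding openin_product_topology_alt by meson
      then show ?thesis
        by (intro that[of V]) auto
    qed
    have "\<exists>A\<in>B. x i \<in> A \<and> A \<subseteq> V i" if "i < n" for i
      using topological_basisE[OF B(2) V(1)[OF that], of "x i"] V(2) that by (metis PiE_mem lessThan_iff)
    then obtain A where A: "\<And>i. i < n \<Longrightarrow> A i \<in> B \<and> x i \<in> A i \<and> A i \<subseteq> V i"
      by metis
    have "Pi\<^sub>E {..<n} (restrict A {..<n}) \<subseteq> Pi\<^sub>E {..<n} V"
      using A by (intro PiE_mono) auto
    then have "restrict A {..<n} \<in> \<W>"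
      using A V(3) by (auto simp: \<W>_def)
    moreover have "x \<in> Pi\<^sub>E {..<n} (restrict A {..<n})"
      using A V(2) by (auto simp: PiE_iff)
    ultimately show ?thesis by blast
  qed
  define e where "e = from_nat_into \<W>"
  have "countable \<W>"
  proof (rule countable_subset)
    show "\<W> \<subseteq> {..<n} \<rightarrow>\<^sub>E B"
      by (auto simp: \<W>_def)
    show "countable ({..<n} \<rightarrow>\<^sub>E B)"
      using B(1) by (intro countable_PiE) auto
  qed
  moreover have "\<W> \<noteq> {}"
    using cover assms(2) by blast
  ultimately have e: "range e = \<W>"
    by (simp add: e_def)
  \<comment> \<open>Outside the index set, \<open>e j i\<close> is the default value \<open>undefined\<close>, which need not be open.\<close>
  define W where "W j = (\<lambda>i. if i < n then e j i else {})" for j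
  have box: "Pi\<^sub>E {..<n} (W j) = Pi\<^sub>E {..<n} (e j)" for j
    by (rule PiE_cong) (simp add: W_def)
  have "e j \<in> \<W>" for j
    using e by blast
  then have "open (W j i)" and "Pi\<^sub>E {..<n} (W j) \<subseteq> U" for j i
    unfolding box using topological_basis_open[OF B(2)] by (auto simp: W_def \<W>_def PiE_iff)
  moreover have "U \<subseteq> (\<Union>j. Pi\<^sub>E {..<n} (W j))"
    unfolding box using cover e by blast
  ultimately show ?thesis
    by (intro that[of W]) auto
qed

text \<open>
  With boxes \<open>W\<^sub>j\<close> covering \<open>U\<close> and approximants \<open>t\<^sub>j\<^sub>k\<close> of their indicators, the functions
  \<open>h\<^sub>k = 1 - (\<Prod>j<k. 1 - t\<^sub>j\<^sub>k)\<close> stay below the indicator of \<open>U\<close> and converge to it.  So the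
  probability of \<open>U\<close> exceeds \<open>c\<close> iff the integral of some \<open>h\<^sub>k\<close> does, and the latter condition
  describes a union of open sets of distributions.
\<close>
lemma open_event_lower_semicontinuous:
  fixes U :: "(nat \<Rightarrow> 'a::polish_space) set"
  assumes U: "openin (product_topology (\<lambda>_. euclidean) {..<n}) U"
    and meas: "U \<in> sets (\<Pi>\<^sub>M i\<in>{..<n}. borel)"
  shows "openin weak_topology {P \<in> borel_probs. measure (\<Pi>\<^sub>M i\<in>{..<n}. P) U > c}"
proof (cases "U = {}")
  case True
  then show ?thesis
    using openin_topspace[of "weak_topology :: 'a measure topology"]
    by (cases "c < 0") (auto simp: topspace_weak_topology)
next
  case False
  obtain W :: "nat \<Rightarrow> nat \<Rightarrow> 'a set"
    where W: "\<And>j i. open (W j i)" "U = (\<Union>j. Pi\<^sub>E {..<n} (W j))"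
    using openin_power_countable_union_boxes[OF U False] by blast
  have "\<exists>f :: nat \<Rightarrow> 'a \<Rightarrow> real. (\<forall>k. continuous_on UNIV (f k)) \<and> (\<forall>k y. f k y \<in> {0..1}) \<and>
     (\<forall>k y. y \<notin> W j i \<longrightarrow> f k y = 0) \<and> (\<forall>y\<in>W j i. (\<lambda>k. f k y) \<longlonglongrightarrow> 1)" for j i
    using open_indicator_approximation[OF W(1)[of j i]] by metis
  then obtain f :: "nat \<Rightarrow> nat \<Rightarrow> nat \<Rightarrow> 'a \<Rightarrow> real"
    where f: "\<And>j i k. continuous_on UNIV (f j i k)" "\<And>j i k y. f j i k y \<in> {0..1}"
      "\<And>j i k y. y \<notin> W j i \<Longrightarrow> f j i k y = 0"
      "\<And>j i y. y \<in> W j i \<Longrightarrow> (\<lambda>k. f j i k y) \<longlonglongrightarrow> 1"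
    by metis
  define t where "t j k x = (\<Prod>i<n. f j i k (x i))" for j k x
  define h where "h k x = 1 - (\<Prod>j<k. 1 - t j k x)" for k :: nat and x
  have t01: "0 \<le> t j k x" "t j k x \<le> 1" for j k x
    unfolding t_def using f(2) by (auto intro!: prod_nonneg prod_le_1)
  have p01: "0 \<le> (\<Prod>j\<in>J. 1 - t j k x)" "(\<Prod>j\<in>J. 1 - t j k x) \<le> 1" for J k x
    using t01 by (auto intro!: prod_nonneg prod_le_1)
  have h_le: "h k x \<le> indicator U x" if x: "x \<in> {..<n} \<rightarrow>\<^sub>E UNIV" for k x
  proof (cases "x \<in> U")
    case True
    then show ?thesis
      using p01 by (simp add: h_def)
  next
    case False
    have "t j k x = 0" for j
    proof -
      have "x \<notin> Pi\<^sub>E {..<n} (W j)"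
        using False W(2) by blast
      then obtain i where "i < n" "x i \<notin> W j i"
        using x by (auto simp: PiE_iff)
      then show ?thesis
        unfolding t_def using f(3) by (intro prod_zero) (auto intro!: bexI[of _ i])
    qed
    then show ?thesis
      using False by (simp add: h_def)
  qed
  have h_lim: "(\<lambda>k. h k x) \<longlonglongrightarrow> indicator U x" if x: "x \<in> {..<n} \<rightarrow>\<^sub>E UNIV" for x
  proof (cases "x \<in> U")
    case True
    then obtain j where j: "x \<in> Pi\<^sub>E {..<n} (W j)"
      using W(2) by blast
    have "(\<lambda>k. t j k x) \<longlonglongrightarrow> (\<Prod>i<n. 1)"
      unfolding t_def using j by (intro tendsto_prod f(4)) (auto simp: PiE_iff)
    then have lim: "(\<lambda>k. t j k x) \<longlonglongrightarrow> 1"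
      by simp
    \<comment> \<open>A single factor already bounds the product, and its box contains \<open>x\<close>.\<close>
    have "t j k x \<le> h k x" if "k > j" for k
    proof -
      have "(\<Prod>j<k. 1 - t j k x) = (1 - t j k x) * (\<Prod>j\<in>{..<k} - {j}. 1 - t j k x)"
        using that by (intro prod.remove) auto
      also have "\<dots> \<le> 1 - t j k x"
        using t01[of j k x] p01 by (intro mult_left_le) auto
      finally show ?thesis
        by (simp add: h_def)
    qed
    then have "eventually (\<lambda>k. t j k x \<le> h k x) sequentially"
      using eventually_gt_at_top[of j] by (rule_tac eventually_mono)
    moreover have "eventually (\<lambda>k. h k x \<le> 1) sequentially"
      using p01 by (simp add: h_def)
    ultimately show ?thesis
      using True tendsto_sandwich[OF _ _ lim tendsto_const[of 1]] by simp
  next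
    case False
    have "h k x = 0" for k
      using h_le[OF x, of k] False p01(2)[where J = "{..<k}" and k = k and x = x] by (simp add: h_def)
    then show ?thesis
      using False by simp
  qed
  have bnd: "bounded (range (f j i k))" for j i k
    using f(2)[of j i k] by (intro boundedI[of _ 1]) auto
  have cont: "continuous_map weak_topology euclideanreal (\<lambda>P. \<integral>x. h k x \<partial>(\<Pi>\<^sub>M i\<in>{..<n}. P))"
    and int: "P \<in> borel_probs \<Longrightarrow> integrable (\<Pi>\<^sub>M i\<in>{..<n}. P) (h k)" for k P
  proof -
    note alg = continuous_map_integral_tensor_algebra[where J = "{..<k}" and g = "\<lambda>_ _. 1"
        and b = "\<lambda>j i. f j i k" and n = n]
    have int': "integrable (\<Pi>\<^sub>M i\<in>{..<n}. P) (\<lambda>x. \<Prod>j<k. 1 - t j k x)" if "P \<in> borel_probs" for P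
      using alg(2)[OF _ f(1) bnd _ _ that] by (simp add: t_def image_constant_conv)
    have "continuous_map weak_topology euclideanreal
        (\<lambda>P. 1 - (\<integral>x. (\<Prod>j<k. 1 - t j k x) \<partial>(\<Pi>\<^sub>M i\<in>{..<n}. P)))"
      using alg(1)[OF _ f(1) bnd]
      by (intro continuous_map_diff) (simp_all add: t_def image_constant_conv)
    then show "continuous_map weak_topology euclideanreal (\<lambda>P. \<integral>x. h k x \<partial>(\<Pi>\<^sub>M i\<in>{..<n}. P))"
    proof (rule continuous_map_eq)
      fix P :: "'a measure" assume "P \<in> topspace weak_topology"
      then have P: "P \<in> borel_probs"
        by (simp add: topspace_weak_topology)
      interpret prob_space "\<Pi>\<^sub>M i\<in>{..<n}. P" using P by (rule prob_space_power)
      show "1 - (\<integral>x. (\<Prod>j<k. 1 - t j k x) \<partial>(\<Pi>\<^sub>M i\<in>{..<n}. P)) = (\<integral>x. h k x \<partial>(\<Pi>\<^sub>M i\<in>{..<n}. P))"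
        unfolding h_def by (subst Bochner_Integration.integral_diff) (use int'[OF P] in \<open>auto simp: prob_space\<close>)
    qed
    assume P: "P \<in> borel_probs"
    interpret prob_space "\<Pi>\<^sub>M i\<in>{..<n}. P" using P by (rule prob_space_power)
    show "integrable (\<Pi>\<^sub>M i\<in>{..<n}. P) (h k)"
      unfolding h_def using int'[OF P] by simp
  qed
  have space: "space (\<Pi>\<^sub>M i\<in>{..<n}. P) = {..<n} \<rightarrow>\<^sub>E UNIV" if "P \<in> borel_probs" for P :: "'a measure"
    using sets_eq_imp_space_eq[OF sets_power[OF that]] by (simp add: space_PiM)
  have "{P \<in> borel_probs. measure (\<Pi>\<^sub>M i\<in>{..<n}. P) U > c} =
      (\<Union>k. {P \<in> topspace weak_topology. (\<integral>x. h k x \<partial>(\<Pi>\<^sub>M i\<in>{..<n}. P)) \<in> {c<..}})"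
  proof -
    have "c < measure (\<Pi>\<^sub>M i\<in>{..<n}. P) U \<longleftrightarrow> (\<exists>k. c < (\<integral>x. h k x \<partial>(\<Pi>\<^sub>M i\<in>{..<n}. P)))"
      if P: "P \<in> borel_probs" for P
    proof -
      interpret prob_space "\<Pi>\<^sub>M i\<in>{..<n}. P" using P by (rule prob_space_power)
      have U_sets: "U \<in> events"
        using meas by (simp add: sets_power[OF P])
      then have U_int: "integrable (\<Pi>\<^sub>M i\<in>{..<n}. P) (indicator U :: _ \<Rightarrow> real)"
        and U_prob: "(\<integral>x. indicator U x \<partial>(\<Pi>\<^sub>M i\<in>{..<n}. P)) = prob U"
        by (simp_all add: emeasure_eq_measure)
      have "(\<integral>x. h k x \<partial>(\<Pi>\<^sub>M i\<in>{..<n}. P)) \<le> prob U" for k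
        unfolding U_prob[symmetric] using h_le space[OF P]
        by (intro integral_mono int P U_int) auto
      moreover have "(\<lambda>k. \<integral>x. h k x \<partial>(\<Pi>\<^sub>M i\<in>{..<n}. P)) \<longlonglongrightarrow> prob U"
        unfolding U_prob[symmetric]
      proof (rule integral_dominated_convergence[where w = "\<lambda>_. 1"])
        show "AE x in \<Pi>\<^sub>M i\<in>{..<n}. P. norm (h k x) \<le> 1" for k
          using p01 by (intro AE_I2) (simp add: h_def abs_le_iff)
        show "AE x in \<Pi>\<^sub>M i\<in>{..<n}. P. (\<lambda>k. h k x) \<longlonglongrightarrow> indicator U x"
          using h_lim space[OF P] by (intro AE_I2) auto
      qed (use U_int int[OF P] in \<open>auto intro: borel_measurable_integrable\<close>)
      ultimately have upper: "\<And>k. (\<integral>x. h k x \<partial>(\<Pi>\<^sub>M i\<in>{..<n}. P)) \<le> prob U"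
        and lim: "(\<lambda>k. \<integral>x. h k x \<partial>(\<Pi>\<^sub>M i\<in>{..<n}. P)) \<longlonglongrightarrow> prob U" .
      show ?thesis
      proof
        assume "c < prob U"
        from order_tendstoD(1)[OF lim this]
        have "eventually (\<lambda>k. c < (\<integral>x. h k x \<partial>(\<Pi>\<^sub>M i\<in>{..<n}. P))) sequentially" .
        then show "\<exists>k. c < (\<integral>x. h k x \<partial>(\<Pi>\<^sub>M i\<in>{..<n}. P))"
          by (rule eventually_happens'[OF sequentially_bot])
      next
        assume "\<exists>k. c < (\<integral>x. h k x \<partial>(\<Pi>\<^sub>M i\<in>{..<n}. P))"
        then show "c < prob U"
          using upper order_less_le_trans by blast
      qed
    qed
    then show ?thesis
      by (auto simp: topspace_weak_topology)
  qed
  moreover have "openin weak_topology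
      {P \<in> topspace weak_topology. (\<integral>x. h k x \<partial>(\<Pi>\<^sub>M i\<in>{..<n}. P)) \<in> {c<..}}" for k
    by (rule openin_continuous_map_preimage[OF cont]) simp
  ultimately show ?thesis
    by auto
qed

section \<open>The two verdicts compete on a comeager set\<close>

text \<open>
  The intersection over all \<open>m\<close> consists of the distributions for which the verdict has
  probability above \<open>1/2\<close> at infinitely many sample sizes.  At the level \<open>1/2\<close> the two verdicts
  cannot both exceed it at the same sample size.
\<close>
definition likely_later ::
  "(nat \<Rightarrow> (nat \<Rightarrow> 'a) \<Rightarrow> verdict) \<Rightarrow> verdict \<Rightarrow> nat \<Rightarrow> 'a::polish_space measure set" where
  "likely_later \<phi> v m =
     {P \<in> borel_probs. \<exists>n>m. measure (\<Pi>\<^sub>M i\<in>{..<n}. P) (event \<phi> n v) > 1/2}"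

lemma event_measurable:
  assumes "is_test \<phi>" and "n \<ge> 1"
  shows "event \<phi> n v \<in> sets (\<Pi>\<^sub>M i\<in>{..<n}. borel)"
proof -
  have "\<phi> n -` {v} \<inter> space (\<Pi>\<^sub>M i\<in>{..<n}. borel) \<in> sets (\<Pi>\<^sub>M i\<in>{..<n}. borel)"
    using assms by (intro measurable_sets[where A = "count_space UNIV"]) (auto simp: is_test_def)
  also have "\<phi> n -` {v} \<inter> space (\<Pi>\<^sub>M i\<in>{..<n}. borel) = event \<phi> n v"
    by (auto simp: event_def space_PiM)
  finally show ?thesis .
qed

lemma openin_likely_later:
  assumes "is_test \<phi>" and "finite_precision \<phi>" and "v \<in> {Verdict0, Verdict1}"
  shows "openin weak_topology (likely_later \<phi> v m)"
proof -
  have "likely_later \<phi> v m =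
      (\<Union>n\<in>{m<..}. {P \<in> borel_probs. measure (\<Pi>\<^sub>M i\<in>{..<n}. P) (event \<phi> n v) > 1/2})"
    by (auto simp: likely_later_def)
  moreover have "openin weak_topology
      {P \<in> borel_probs. measure (\<Pi>\<^sub>M i\<in>{..<n}. P) (event \<phi> n v) > 1/2}" if "n > m" for n
  proof (rule open_event_lower_semicontinuous)
    show "openin (product_topology (\<lambda>_. euclidean) {..<n}) (event \<phi> n v)"
      using assms(2,3) that by (auto simp: finite_precision_def)
    show "event \<phi> n v \<in> sets (\<Pi>\<^sub>M i\<in>{..<n}. borel)"
      using assms(1) that by (intro event_measurable) auto
  qed
  ultimately show ?thesis
    by auto
qed

lemma consistent_at_eventually_likely:
  assumes "consistent_at \<phi> v P"
  shows "\<exists>N. \<forall>n\<ge>N. measure (\<Pi>\<^sub>M i\<in>{..<n}. P) (event \<phi> n v) > 1/2"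
proof -
  have "(1/2 :: real) < 1" by simp
  with assms have "eventually (\<lambda>n. measure (\<Pi>\<^sub>M i\<in>{..<n}. P) (event \<phi> n v) > 1/2) sequentially"
    unfolding consistent_at_def by (rule order_tendstoD(1))
  then show ?thesis
    unfolding eventually_sequentially .
qed

lemma consistent_at_likely_later:
  assumes "consistent_at \<phi> v P" and "P \<in> borel_probs"
  shows "P \<in> likely_later \<phi> v m"
proof -
  obtain N where "\<forall>n\<ge>N. measure (\<Pi>\<^sub>M i\<in>{..<n}. P) (event \<phi> n v) > 1/2"
    using consistent_at_eventually_likely[OF assms(1)] by blast
  then have "measure (\<Pi>\<^sub>M i\<in>{..<max N (Suc m)}. P) (event \<phi> (max N (Suc m)) v) > 1/2"
    by simp
  then show ?thesis
    using assms(2) unfolding likely_later_def by (auto intro!: exI[of _ "max N (Suc m)"])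
qed

lemma consistent_at_other_unlikely:
  assumes "is_test \<phi>" and "consistent_at \<phi> v P" and "P \<in> borel_probs" and "w \<noteq> v"
  shows "\<exists>m. P \<notin> likely_later \<phi> w m"
proof -
  obtain N where N: "\<And>n. n \<ge> N \<Longrightarrow> measure (\<Pi>\<^sub>M i\<in>{..<n}. P) (event \<phi> n v) > 1/2"
    using consistent_at_eventually_likely[OF assms(2)] by blast
  have "measure (\<Pi>\<^sub>M i\<in>{..<n}. P) (event \<phi> n w) \<le> 1/2" if n: "n > N" for n
  proof -
    interpret prob_space "\<Pi>\<^sub>M i\<in>{..<n}. P" using assms(3) by (rule prob_space_power)
    have "event \<phi> n u \<in> events" for u
      unfolding sets_power[OF assms(3)] using assms(1) n by (intro event_measurable) auto
    then have "prob (event \<phi> n v \<union> event \<phi> n w) = prob (event \<phi> n v) + prob (event \<phi> n w)"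
      using assms(4) by (intro finite_measure_Union) (simp_all add: event_def disjoint_iff)
    then show ?thesis
      using N[of n] n prob_le_1[of "event \<phi> n v \<union> event \<phi> n w"] by auto
  qed
  then have "P \<notin> likely_later \<phi> w N"
    by (force simp: likely_later_def)
  then show ?thesis ..
qed

lemma nowhere_dense_not_likely_later:
  fixes E :: "'a::polish_space measure set"
  assumes "is_test \<phi>" and "finite_precision \<phi>" and "v \<in> {Verdict0, Verdict1}"
    and E: "E \<subseteq> borel_probs"
    and D: "dense_in (subtopology weak_topology E) D" "\<And>P. P \<in> D \<Longrightarrow> consistent_at \<phi> v P"
  shows "nowhere_dense_in (subtopology weak_topology E) (E - likely_later \<phi> v m)"
proof -
  have top: "topspace (subtopology weak_topology E) = E"
    using E by (auto simp: topspace_weak_topology)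
  have "D \<subseteq> E"
    using D(1) unfolding dense_in_def top by blast
  then have "D \<subseteq> E \<inter> likely_later \<phi> v m"
    using E D(2) consistent_at_likely_later by blast
  moreover have "openin (subtopology weak_topology E) (E \<inter> likely_later \<phi> v m)"
    using openin_likely_later[OF assms(1-3)] by (rule openin_subtopology_Int2)
  ultimately have "nowhere_dense_in (subtopology weak_topology E)
      (topspace (subtopology weak_topology E) - E \<inter> likely_later \<phi> v m)"
    using D(1) by (intro nowhere_dense_in_complement_of_open_dense)
  then show ?thesis
    unfolding top by (simp add: Diff_Int)
qed

theorem theorem1:
  fixes H0 H1 :: "'a::polish_space measure set"
  assumes "testing_problem H0 H1"
    and "dense_in (subtopology weak_topology (H0 \<union> H1)) H0"
    and "dense_in (subtopology weak_topology (H0 \<union> H1)) H1"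
  shows "\<not> (\<exists>\<phi>. is_test \<phi> \<and> finite_precision \<phi> \<and>
    densely_consistent_in_each \<phi> H0 H1 \<and> nonmeagerly_consistent \<phi> H0 H1)"
proof (rule notI, elim exE conjE)
  fix \<phi> :: "nat \<Rightarrow> (nat \<Rightarrow> 'a) \<Rightarrow> verdict"
  assume test: "is_test \<phi>" and prec: "finite_precision \<phi>"
    and dense: "densely_consistent_in_each \<phi> H0 H1"
    and nonmeager: "nonmeagerly_consistent \<phi> H0 H1"
  define X where "X = subtopology weak_topology (H0 \<union> H1)"
  have sub: "H0 \<union> H1 \<subseteq> borel_probs"
    using assms(1) unfolding testing_problem_def by auto
  define Z where "Z v m = (H0 \<union> H1) - likely_later \<phi> v m" for v m
  have relative: "subtopology X H0 = subtopology weak_topology H0"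
      "subtopology X H1 = subtopology weak_topology H1"
    unfolding X_def subtopology_subtopology by (simp_all add: Int_absorb1)
  have Z0: "nowhere_dense_in X (Z Verdict0 m)" for m
  proof -
    obtain D where D: "dense_in (subtopology weak_topology H0) D" "consistent_on \<phi> H0 H1 D"
      using dense unfolding densely_consistent_in_each_def by blast
    have "D \<subseteq> H0"
      using D(1) unfolding dense_in_def by auto
    then have "consistent_at \<phi> Verdict0 P" if "P \<in> D" for P
      using D(2) that unfolding consistent_on_def by blast
    moreover have "dense_in X D"
      using D(1) assms(2) unfolding relative[symmetric] X_def[symmetric] by (rule dense_in_trans)
    ultimately show ?thesis
      unfolding X_def Z_def by (intro nowhere_dense_not_likely_later test prec sub) simp_all
  qed
  have Z1: "nowhere_dense_in X (Z Verdict1 m)" for m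
  proof -
    obtain D where D: "dense_in (subtopology weak_topology H1) D" "consistent_on \<phi> H0 H1 D"
      using dense unfolding densely_consistent_in_each_def by blast
    have "D \<subseteq> H1"
      using D(1) unfolding dense_in_def by auto
    then have "consistent_at \<phi> Verdict1 P" if "P \<in> D" for P
      using D(2) that unfolding consistent_on_def by blast
    moreover have "dense_in X D"
      using D(1) assms(3) unfolding relative[symmetric] X_def[symmetric] by (rule dense_in_trans)
    ultimately show ?thesis
      unfolding X_def Z_def by (intro nowhere_dense_not_likely_later test prec sub) simp_all
  qed
  obtain S where S: "\<not> meager_in X S" "consistent_on \<phi> H0 H1 S"
    using nonmeager unfolding nonmeagerly_consistent_def nonmeager_in_def X_def by blast
  \<comment> \<open>Where the test is consistent, the wrong verdict is eventually unlikely, so \<open>S\<close> lies outside the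
    comeager set on which both verdicts are likely infinitely often.\<close>
  have "S \<subseteq> \<Union>(range (Z Verdict0) \<union> range (Z Verdict1))"
  proof
    fix P assume P: "P \<in> S"
    then have PH: "P \<in> H0 \<union> H1"
      using S(2) unfolding consistent_on_def by blast
    then have Pb: "P \<in> borel_probs"
      using sub by blast
    consider "consistent_at \<phi> Verdict0 P" | "consistent_at \<phi> Verdict1 P"
      using S(2) P PH unfolding consistent_on_def by blast
    then show "P \<in> \<Union>(range (Z Verdict0) \<union> range (Z Verdict1))"
    proof cases
      case 1
      then obtain m where "P \<notin> likely_later \<phi> Verdict1 m"
        using consistent_at_other_unlikely[OF test 1 Pb, of Verdict1] by auto
      then show ?thesis
        using PH unfolding Z_def by blast
    next
      case 2
      then obtain m where "P \<notin> likely_later \<phi> Verdict0 m"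
        using consistent_at_other_unlikely[OF test 2 Pb, of Verdict0] by auto
      then show ?thesis
        using PH unfolding Z_def by blast
    qed
  qed
  then have "meager_in X S"
    by (rule meager_in_if_covered[rotated 2]) (use Z0 Z1 in auto)
  then show False
    using S(1) by contradiction
qed

end
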